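(* Let $B:\mathbb{R}\to\mathbb{R}$ be an admissible function (as defined in the context). Let $u:\mathbb{R}\to\mathbb{R}$ be smooth and suppose there exist constants $a>0$, $M>0$ such that $x\,u'(x)\ge a|x|^2$ for all $|x|>M$. Then there exist $h_0>0$ and a constant $\kappa>0$, independent of $h$, such that for every $0<h<h_0$ and every $f^h\in\mathcal{H}^1(\pi^h)$, $$\left\langle (f^h)^2,\pi^h\right\rangle-\left\langle f^h,\pi^h\right\rangle^2\le\frac1\kappa\left\langle\Gamma^h(f^h,f^h),\pi^h\right\rangle .$$
   Context: A function $B:\mathbb{R}\to\mathbb{R}$ is called admissible if $B\in C^1(\mathbb{R})$, $B$ is Lipschitz continuous, $B(0)=1$, $B(s)>0$ for all $s$, $\ln B(-s)-\ln B(s)=s$ for all $s$, and $B$ is monotonically decreasing. Given a potential $u$ and a step size $h>0$, set $x_i=ih$, $u_i=u(x_i)$ for $i\in\mathbb{Z}$, and $$\alpha_i=\frac{1}{h^2}B(u_{i+1}-u_i),\qquad \beta_i=\frac1{h^2}B(u_{i-1}-u_i),\qquad \pi_i=\frac{e^{-u_i}}{\sum_{j\in\mathbb{Z}}e^{-u_j}},\qquad \pi^h=\{\pi_i\}_{i\in\mathbb{Z}}.$$ For sequences $f^h=\{f_i\}_{i\in\mathbb{Z}}$, $g^h=\{g_i\}_{i\in\mathbb{Z}}$ of real numbers: $\langle f^h,g^h\rangle=\sum_{i\in\mathbb{Z}}f_ig_i$; products and squares are componentwise; $\Delta^+f_i=f_{i+1}-f_i$, $\Delta^-f_i=f_i-f_{i-1}$;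 $$\left(\Gamma^h(f^h,g^h)\right)_i=\tfrac12\alpha_i\Delta^+f_i\Delta^+g_i+\tfrac12\beta_i\Delta^-f_i\Delta^-g_i.$$ $\mathcal{H}^1(\pi^h)$ is the set of real sequences $f^h$ with $\langle (f^h)^2,\pi^h\rangle+\langle\Gamma^h(f^h,f^h),\pi^h\rangle<+\infty$. *)

theory Defs
  imports "HOL-Analysis.Analysis"
begin

text \<open>``Monotonically decreasing'' is read in the weak (non-strict) sense.\<close>

definition admissible :: "(real \<Rightarrow> real) \<Rightarrow> bool" where
  "admissible B \<longleftrightarrow>
     B C1_differentiable_on UNIV \<and>
     (\<exists>L. L-lipschitz_on UNIV B) \<and>
     B 0 = 1 \<and>
     (\<forall>s. B s > 0) \<and>
     (\<forall>s. ln (B (- s)) - ln (B s) = s) \<and>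
     antimono B"

definition smooth :: "(real \<Rightarrow> real) \<Rightarrow> bool" where
  "smooth u \<longleftrightarrow> (\<forall>n x. (deriv ^^ n) u field_differentiable (at x))"

text \<open>Sequences indexed by the integers are functions of type \<^typ>\<open>int \<Rightarrow> real\<close>.\<close>

definition grid :: "(real \<Rightarrow> real) \<Rightarrow> real \<Rightarrow> int \<Rightarrow> real" where
  "grid u h i = u (of_int i * h)"

definition alpha :: "(real \<Rightarrow> real) \<Rightarrow> (real \<Rightarrow> real) \<Rightarrow> real \<Rightarrow> int \<Rightarrow> real" where
  "alpha B u h i = 1 / h\<^sup>2 * B (grid u h (i + 1) - grid u h i)"

definition beta :: "(real \<Rightarrow> real) \<Rightarrow> (real \<Rightarrow> real) \<Rightarrow> real \<Rightarrow> int \<Rightarrow> real" where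
  "beta B u h i = 1 / h\<^sup>2 * B (grid u h (i - 1) - grid u h i)"

definition pi_h :: "(real \<Rightarrow> real) \<Rightarrow> real \<Rightarrow> int \<Rightarrow> real" where
  "pi_h u h i = exp (- grid u h i) / (\<Sum>\<^sub>\<infinity>j. exp (- grid u h j))"

text \<open>The sum is unconditional; \<^const>\<open>infsum\<close> is 0 if it does not converge.\<close>

definition pairing :: "(int \<Rightarrow> real) \<Rightarrow> (int \<Rightarrow> real) \<Rightarrow> real" where
  "pairing f g = (\<Sum>\<^sub>\<infinity>i. f i * g i)"

definition Delta_plus :: "(int \<Rightarrow> real) \<Rightarrow> int \<Rightarrow> real" where
  "Delta_plus f i = f (i + 1) - f i"

definition Delta_minus :: "(int \<Rightarrow> real) \<Rightarrow> int \<Rightarrow> real" where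
  "Delta_minus f i = f i - f (i - 1)"

definition Gamma_h ::
  "(real \<Rightarrow> real) \<Rightarrow> (real \<Rightarrow> real) \<Rightarrow> real \<Rightarrow> (int \<Rightarrow> real) \<Rightarrow> (int \<Rightarrow> real) \<Rightarrow> int \<Rightarrow> real" where
  "Gamma_h B u h f g i =
     1 / 2 * alpha B u h i * Delta_plus f i * Delta_plus g i +
     1 / 2 * beta B u h i * Delta_minus f i * Delta_minus g i"

text \<open>
  For admissible \<^term>\<open>B\<close> the two series below have nonnegative terms, so summability
  says exactly that \<open>\<langle>f\<^sup>2, \<pi>\<rangle> + \<langle>\<Gamma>(f, f), \<pi>\<rangle> < \<infinity>\<close>.
\<close>

definition H1 :: "(real \<Rightarrow> real) \<Rightarrow> (real \<Rightarrow> real) \<Rightarrow> real \<Rightarrow> (int \<Rightarrow> real) set" where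
  "H1 B u h =
     {f. (\<lambda>i. (f i)\<^sup>2 * pi_h u h i) summable_on UNIV \<and>
         (\<lambda>i. Gamma_h B u h f f i * pi_h u h i) summable_on UNIV}"

end

theory Submission
  imports Defs
begin

text \<open>
  Let \<open>w\<^sub>i = exp (- u\<^sub>i)\<close>. Monotonicity of \<open>B\<close> together with \<open>B (- s) = exp s * B s\<close> gives
  \<open>w\<^sub>i B (u\<^sub>j - u\<^sub>i) \<ge> min w\<^sub>i w\<^sub>j\<close>, so the Dirichlet form dominates the one with edge weights
  \<open>min w\<^sub>i w\<^sub>j / h\<^sup>2\<close>. The growth condition on \<open>u\<close> makes the tails of \<open>w\<close> on each half-line at most
  \<open>C / h\<close> times the adjacent edge weight, with \<open>C\<close> independent of \<open>h\<close>. Summation by parts and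
  AM-GM then turn this tail bound into a Hardy inequality for sequences vanishing at the origin,
  and the variance of \<open>f\<close> is at most the second moment of \<open>f - f\<^sub>0\<close>.
\<close>

section \<open>Edge weights and growth of the potential\<close>

text \<open>Since \<open>B 0 = 1\<close> and \<open>B\<close> decreases, \<open>B\<close> is at
  least 1 on nonpositive arguments, which settles \<open>q \<le> p\<close>. Otherwise detailed
  balance, \<open>exp (- p) * B (q - p) = exp (- q) * B (p - q)\<close>, exchanges the two
  endpoints.\<close>

lemma admissible_edge_weight:
  assumes "admissible B"
  shows "min (exp (- p)) (exp (- q)) \<le> exp (- p) * B (q - p)"
proof -
  have B0: "B 0 = 1" and pos: "\<And>s. B s > 0" and ln: "\<And>s. ln (B (- s)) - ln (B s) = s"
    and anti: "antimono B"
    using assms unfolding admissible_def by auto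
  have ge1: "B s \<ge> 1" if "s \<le> 0" for s
    using antimonoD[OF anti that] B0 by simp
  show ?thesis
  proof (cases "q \<le> p")
    case True
    have "exp (- p) * 1 \<le> exp (- p) * B (q - p)"
      by (rule mult_left_mono) (use ge1[of "q - p"] True in auto)
    then show ?thesis by linarith
  next
    case False
    have "ln (B (q - p)) = ln (B (p - q)) - (q - p)"
      using ln[of "q - p"] by simp
    then have "B (q - p) = exp (ln (B (p - q)) - (q - p))"
      using pos[of "q - p"] by (metis exp_ln)
    also have "\<dots> = B (p - q) * exp (p - q)"
      using pos[of "p - q"] by (simp add: exp_diff)
    finally have "exp (- p) * B (q - p) = exp (- q) * B (p - q)"
      using exp_add[of "- p" "p - q"] by simp
    moreover have "exp (- q) * 1 \<le> exp (- q) * B (p - q)"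
      by (rule mult_left_mono) (use ge1[of "p - q"] False in auto)
    ultimately show ?thesis by linarith
  qed
qed

text \<open>The function \<open>v x - c * x\<close> is nondecreasing beyond \<open>M\<close> and
  bounded on the compact interval from 0 to \<open>M\<close>. So its drop between ordered
  nonnegative points is bounded by a constant, and \<open>L\<close> absorbs whatever
  \<open>v\<close> does near the origin.\<close>

lemma linear_growth_from_derivative:
  fixes v v' :: "real \<Rightarrow> real"
  assumes der: "\<And>x. (v has_real_derivative v' x) (at x)"
    and "M > 0" and ge: "\<And>x. x > M \<Longrightarrow> v' x \<ge> c"
  shows "\<exists>L. \<forall>x y. 0 \<le> x \<longrightarrow> x \<le> y \<longrightarrow> c * (y - x) - L \<le> v y - v x"
proof -
  define z where "z x = v x - c * x" for x
  have dz: "(z has_real_derivative v' x - c) (at x)" for x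
    unfolding z_def by (auto intro!: derivative_eq_intros der)
  have mono: "z x \<le> z y" if "M \<le> x" "x \<le> y" for x y
  proof (rule DERIV_nonneg_imp_increasing_open[OF that(2)])
    show "\<exists>d. (z has_real_derivative d) (at t) \<and> 0 \<le> d" if "x < t" "t < y" for t
      using dz[of t] ge[of t] that \<open>M \<le> x\<close> by (intro exI[of _ "v' t - c"]) auto
    show "continuous_on {x..y} z"
      using dz by (meson DERIV_isCont continuous_at_imp_continuous_on)
  qed
  have "compact (z ` {0..M})"
    using dz by (intro compact_continuous_image) (auto intro!: continuous_at_imp_continuous_on DERIV_isCont)
  then obtain L where L: "\<And>x. x \<in> {0..M} \<Longrightarrow> \<bar>z x\<bar> \<le> L"
    using compact_imp_bounded bounded_iff by (metis imageI real_norm_def)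
  \<comment> \<open>Two values of \<open>z\<close> on the compact part differ by at most
    \<open>2 * L\<close>; if only \<open>y\<close> exceeds \<open>M\<close>, the comparison passes
    through \<open>z M\<close>.\<close>
  have "c * (y - x) - 2 * L \<le> v y - v x" if "0 \<le> x" "x \<le> y" for x y
  proof -
    have "z x - 2 * L \<le> z y"
    proof (cases "y \<le> M")
      case True
      then show ?thesis using L[of x] L[of y] that by auto
    next
      case False
      then show ?thesis
        using mono[of M y] mono[of x y] L[of x] L[of M] that \<open>M > 0\<close> by (cases "x \<le> M") auto
    qed
    then show ?thesis by (simp add: z_def algebra_simps)
  qed
  then show ?thesis by blast
qed

section \<open>Weighted discrete Hardy inequality\<close>

text \<open>Abel summation: the increment of \<open>G\<close> at \<open>k\<close> enters every later
  \<open>G j\<close>, so it collects the tail of \<open>w\<close> beyond \<open>k\<close>.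
  Truncating the tails at \<open>N\<close> avoids any question of convergence.\<close>

lemma sum_by_parts_tail:
  fixes w G :: "nat \<Rightarrow> real"
  assumes "G 0 = 0"
  shows "(\<Sum>i\<le>N. w i * G i) = (\<Sum>k<N. (\<Sum>j=Suc k..N. w j) * (G (Suc k) - G k))"
proof (induction N)
  case (Suc N)
  have "(\<Sum>k<Suc N. (\<Sum>j=Suc k..Suc N. w j) * (G (Suc k) - G k))
      = (\<Sum>k<Suc N. (\<Sum>j=Suc k..N. w j) * (G (Suc k) - G k) + w (Suc N) * (G (Suc k) - G k))"
    by (intro sum.cong) (auto simp: algebra_simps)
  also have "\<dots> = (\<Sum>k<N. (\<Sum>j=Suc k..N. w j) * (G (Suc k) - G k))
      + w (Suc N) * (\<Sum>k<Suc N. G (Suc k) - G k)"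
    by (simp only: sum.distrib sum_distrib_left) simp
  also have "(\<Sum>k<Suc N. G (Suc k) - G k) = G (Suc N)"
    using assms by (simp only: sum_lessThan_telescope)
  finally show ?case using Suc.IH by simp
qed (simp add: assms)

text \<open>Summation by parts applied to the squares of \<open>g\<close> produces tails times
  differences of squares. The tail bound and a weighted AM-GM split each product into a gradient
  term and a share of the left-hand side small enough to be absorbed.\<close>

lemma discrete_hardy:
  fixes w m g :: "nat \<Rightarrow> real"
  assumes m0: "\<And>k. 0 \<le> m k" and mw: "\<And>k. m k \<le> w k" "\<And>k. m k \<le> w (Suc k)"
    and g0: "g 0 = 0"
    and tail: "\<And>k. (\<Sum>j=Suc k..N. w j) \<le> C * m k"
  shows "(\<Sum>i\<le>N. w i * (g i)\<^sup>2) \<le> 4 * C\<^sup>2 * (\<Sum>k<N. m k * (g (Suc k) - g k)\<^sup>2)"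
proof -
  define S where "S = (\<Sum>i\<le>N. w i * (g i)\<^sup>2)"
  define D where "D = (\<Sum>k<N. m k * (g (Suc k) - g k)\<^sup>2)"
  have w0: "0 \<le> w k" for k using m0 mw(1) order_trans by blast
  have step: "(\<Sum>j=Suc k..N. w j) * ((g (Suc k))\<^sup>2 - (g k)\<^sup>2)
      \<le> 2 * C\<^sup>2 * (m k * (g (Suc k) - g k)\<^sup>2) + (w k * (g k)\<^sup>2 + w (Suc k) * (g (Suc k))\<^sup>2) / 4" for k
  proof -
    define d e where "d = g (Suc k) - g k" and "e = g (Suc k) + g k"
    have "(\<Sum>j=Suc k..N. w j) * ((g (Suc k))\<^sup>2 - (g k)\<^sup>2) = (\<Sum>j=Suc k..N. w j) * (d * e)"
      by (simp add: d_def e_def power2_eq_square algebra_simps)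
    also have "\<dots> \<le> (\<Sum>j=Suc k..N. w j) * \<bar>d * e\<bar>"
      by (intro mult_left_mono sum_nonneg w0) auto
    also have "\<dots> \<le> C * m k * \<bar>d * e\<bar>"
      by (intro mult_right_mono tail) auto
    also have "\<dots> = m k * (C * \<bar>d\<bar> * \<bar>e\<bar>)" by (simp add: abs_mult)
    \<comment> \<open>The weight 1/8 is chosen for the absorption: after \<open>e\<close> is split
      into its two summands, each endpoint carries the factor 1/4, and every index is an endpoint of
      at most two edges.\<close>
    also have "C * \<bar>d\<bar> * \<bar>e\<bar> \<le> 2 * C\<^sup>2 * d\<^sup>2 + e\<^sup>2 / 8"
    proof -
      have "0 \<le> (4 * (C * \<bar>d\<bar>) - \<bar>e\<bar>)\<^sup>2" by simp
      then show ?thesis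
        unfolding power2_diff by (simp add: power_mult_distrib algebra_simps)
    qed
    also have "e\<^sup>2 \<le> 2 * ((g k)\<^sup>2 + (g (Suc k))\<^sup>2)"
      using sum_squares_bound[of "g k" "g (Suc k)"] by (simp add: e_def power2_sum mult.commute mult.left_commute)
    finally have "(\<Sum>j=Suc k..N. w j) * ((g (Suc k))\<^sup>2 - (g k)\<^sup>2)
        \<le> m k * (2 * C\<^sup>2 * d\<^sup>2 + 2 * ((g k)\<^sup>2 + (g (Suc k))\<^sup>2) / 8)"
      using m0[of k] by (simp add: mult_left_mono)
    also have "\<dots> = 2 * C\<^sup>2 * (m k * d\<^sup>2) + (m k * (g k)\<^sup>2 + m k * (g (Suc k))\<^sup>2) / 4"
      by (simp add: field_simps)
    also have "\<dots> \<le> 2 * C\<^sup>2 * (m k * d\<^sup>2) + (w k * (g k)\<^sup>2 + w (Suc k) * (g (Suc k))\<^sup>2) / 4"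
      by (intro add_left_mono divide_right_mono add_mono mult_right_mono mw) auto
    finally show ?thesis by (simp add: d_def)
  qed
  have "S = (\<Sum>k<N. (\<Sum>j=Suc k..N. w j) * ((g (Suc k))\<^sup>2 - (g k)\<^sup>2))"
    unfolding S_def by (rule sum_by_parts_tail) (simp add: g0)
  also have "\<dots> \<le> (\<Sum>k<N. 2 * C\<^sup>2 * (m k * (g (Suc k) - g k)\<^sup>2)
      + (w k * (g k)\<^sup>2 + w (Suc k) * (g (Suc k))\<^sup>2) / 4)"
    by (intro sum_mono step)
  also have "\<dots> = 2 * C\<^sup>2 * D
      + ((\<Sum>k<N. w k * (g k)\<^sup>2) + (\<Sum>k<N. w (Suc k) * (g (Suc k))\<^sup>2)) / 4"
    by (simp only: D_def sum.distrib sum_distrib_left flip: sum_divide_distrib)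
  finally have "S \<le> 2 * C\<^sup>2 * D
      + ((\<Sum>k<N. w k * (g k)\<^sup>2) + (\<Sum>k<N. w (Suc k) * (g (Suc k))\<^sup>2)) / 4" .
  \<comment> \<open>Both endpoint sums are at most \<open>S\<close> (the shifted one because
    \<open>g 0 = 0\<close>), so the error is at most \<open>S / 2\<close>; moving it to the left
    doubles the constant 2 to 4.\<close>
  moreover have "(\<Sum>k<N. w k * (g k)\<^sup>2) \<le> S"
    unfolding S_def by (intro sum_mono2) (auto simp: w0)
  moreover have "(\<Sum>k<N. w (Suc k) * (g (Suc k))\<^sup>2) = S"
    unfolding S_def lessThan_Suc_atMost[symmetric] sum.lessThan_Suc_shift by (simp add: g0)
  ultimately have "S \<le> 4 * C\<^sup>2 * D" by (simp add: field_simps)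
  then show ?thesis by (simp only: S_def D_def)
qed

section \<open>Tails of the exponential weights\<close>

text \<open>Bounds a geometric series of ratio \<open>exp (- t)\<close> by order
  \<open>1 / t\<close>, via \<open>exp (- t) \<le> 1 / (1 + t) \<le> 1 - t / 2\<close>. The range
  \<open>t \<le> 1\<close> is the origin of the step-size threshold.\<close>

lemma inverse_one_minus_exp_le:
  fixes t :: real
  assumes "0 < t" "t \<le> 1"
  shows "1 / (1 - exp (- t)) \<le> 2 / t"
proof -
  have "exp (- t) \<le> 1 / (1 + t)"
    using exp_ge_add_one_self[of t] assms by (simp add: exp_minus inverse_eq_divide frac_le)
  also have "\<dots> \<le> 1 - t / 2"
  proof -
    have "t * t \<le> t * 1" using assms by (intro mult_left_mono) auto
    then show ?thesis using assms by (simp add: field_simps)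
  qed
  finally show ?thesis using assms by (simp add: field_simps)
qed

text \<open>Linear growth makes the weights decay geometrically with ratio
  \<open>exp (- (c * h))\<close>, up to the factor \<open>exp L\<close>. The bound is uniform in
  \<open>N\<close> and loses only one factor \<open>1 / h\<close>.\<close>

lemma exp_weight_tail:
  fixes v :: "real \<Rightarrow> real"
  assumes growth: "\<And>x y. 0 \<le> x \<Longrightarrow> x \<le> y \<Longrightarrow> c * (y - x) - L \<le> v y - v x"
    and "c > 0" "h > 0" "c * h \<le> 1"
  shows "(\<Sum>j=l..N. exp (- v (real j * h))) \<le> 2 * exp L / (c * h) * exp (- v (real l * h))"
proof -
  define q where "q = exp (- (c * h))"
  have q: "0 < q" "q < 1" using assms by (auto simp: q_def)
  have decay: "exp (- v (real j * h)) \<le> exp L * exp (- v (real l * h)) * q ^ (j - l)" if "l \<le> j" for j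
  proof -
    have "c * (real j * h - real l * h) - L \<le> v (real j * h) - v (real l * h)"
      using that assms by (intro growth) auto
    then have "- v (real j * h) \<le> L + (- v (real l * h)) + real (j - l) * (- (c * h))"
      using that by (simp add: of_nat_diff algebra_simps)
    then show ?thesis
      unfolding q_def exp_of_nat_mult[symmetric] exp_add[symmetric] by simp
  qed
  have "(\<Sum>j=l..N. exp (- v (real j * h))) \<le> (\<Sum>j=l..N. exp L * exp (- v (real l * h)) * q ^ (j - l))"
    by (intro sum_mono decay) auto
  also have "\<dots> = exp L * exp (- v (real l * h)) * (\<Sum>j=l..N. q ^ (j - l))"
    by (simp add: sum_distrib_left)
  also have "(\<Sum>j=l..N. q ^ (j - l)) = (\<Sum>i<Suc N - l. q ^ i)"
    by (rule sum.reindex_bij_witness[of _ "\<lambda>i. i + l" "\<lambda>j. j - l"]) auto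
  also have "\<dots> \<le> 1 / (1 - q)"
    using q by (simp add: sum_gp_strict divide_right_mono)
  also have "\<dots> \<le> 2 / (c * h)"
    unfolding q_def using assms by (intro inverse_one_minus_exp_le) auto
  finally show ?thesis by (simp add: mult_left_mono field_simps)
qed

lemma half_line_hardy:
  fixes v :: "real \<Rightarrow> real" and g :: "nat \<Rightarrow> real" and h :: real
  defines "w \<equiv> \<lambda>i. exp (- v (real i * h))"
  assumes growth: "\<And>x y. 0 \<le> x \<Longrightarrow> x \<le> y \<Longrightarrow> c * (y - x) - L \<le> v y - v x"
    and ch: "c > 0" "h > 0" "c * h \<le> 1" and "g 0 = 0"
  shows "(\<Sum>i\<le>N. w i * (g i)\<^sup>2)
    \<le> 4 * (2 * exp L / (c * h))\<^sup>2 * (\<Sum>k<N. min (w k) (w (Suc k)) * (g (Suc k) - g k)\<^sup>2)"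
proof (rule discrete_hardy)
  define C where "C = 2 * exp L / (c * h)"
  have tl: "(\<Sum>j=l..N. w j) \<le> C * w l" for l
    unfolding w_def C_def by (rule exp_weight_tail[OF growth ch])
  show "(\<Sum>j=Suc k..N. w j) \<le> 2 * exp L / (c * h) * min (w k) (w (Suc k))" for k
  proof -
    \<comment> \<open>Starting the tail at \<open>Suc k\<close> or, after enlarging it, at
      \<open>k\<close> controls it by either endpoint weight, hence by their minimum.\<close>
    have "(\<Sum>j=Suc k..N. w j) \<le> (\<Sum>j=k..N. w j)"
      by (intro sum_mono2) (auto simp: w_def)
    then show ?thesis
      using tl[of k] tl[of "Suc k"] unfolding C_def[symmetric] by (simp add: min_def)
  qed
qed (use assms in \<open>auto simp: w_def\<close>)

section \<open>Sums over the integers and variance\<close>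

text \<open>A finite set of integers lies in a symmetric interval, which two half-lines cover. The
  origin is counted twice, which is harmless for nonnegative terms.\<close>

lemma sum_int_le_half_lines:
  fixes F :: "int \<Rightarrow> real"
  assumes nn: "\<And>i. 0 \<le> F i" and "finite X"
    and pos: "\<And>N. (\<Sum>i\<le>N. F (int i)) \<le> P" and neg: "\<And>N. (\<Sum>i\<le>N. F (- int i)) \<le> Q"
  shows "sum F X \<le> P + Q"
proof -
  define N where "N = nat (Max (insert 0 (abs ` X)))"
  have le: "\<bar>i\<bar> \<le> int N" if "i \<in> X" for i
    using Max_ge[of "insert 0 (abs ` X)" "\<bar>i\<bar>"] that \<open>finite X\<close> by (auto simp: N_def)
  have "X \<subseteq> int ` {..N} \<union> (\<lambda>i. - int i) ` {..N}"
  proof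
    fix i assume "i \<in> X"
    then have "\<bar>i\<bar> \<le> int N" by (rule le)
    then show "i \<in> int ` {..N} \<union> (\<lambda>i. - int i) ` {..N}"
      by (cases "0 \<le> i") (auto intro!: image_eqI[of _ _ "nat \<bar>i\<bar>"])
  qed
  then have "sum F X \<le> sum F (int ` {..N} \<union> (\<lambda>i. - int i) ` {..N})"
    by (intro sum_mono2) (auto simp: nn)
  also have "\<dots> \<le> sum F (int ` {..N}) + sum F ((\<lambda>i. - int i) ` {..N})"
    by (simp add: sum_Un nn sum_nonneg)
  also have "\<dots> = (\<Sum>i\<le>N. F (int i)) + (\<Sum>i\<le>N. F (- int i))"
    by (subst (1 2) sum.reindex) (auto simp: inj_on_def)
  also have "\<dots> \<le> P + Q" by (intro add_mono pos neg)
  finally show ?thesis .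
qed

text \<open>The second moment about \<open>t\<close> is the variance plus the square of
  \<open>pairing f p - t\<close>.\<close>

lemma variance_le_second_moment:
  fixes p f :: "int \<Rightarrow> real"
  assumes p0: "\<And>i. 0 \<le> p i" and p: "p summable_on UNIV" "infsum p UNIV = 1"
    and f2: "(\<lambda>i. (f i)\<^sup>2 * p i) summable_on UNIV"
  shows "(\<lambda>i. (f i - t)\<^sup>2 * p i) summable_on UNIV"
    and "pairing (\<lambda>i. (f i)\<^sup>2) p - (pairing f p)\<^sup>2 \<le> (\<Sum>\<^sub>\<infinity>i. (f i - t)\<^sup>2 * p i)"
proof -
  \<comment> \<open>This majorant makes \<open>f i * p i\<close> summable, so that
    \<open>pairing f p\<close> is a genuine mean and not the default value 0.\<close>
  have "(\<lambda>i. (f i)\<^sup>2 * p i + p i) summable_on UNIV"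
    by (intro summable_on_add f2 p)
  then have "(\<lambda>i. norm (f i * p i)) summable_on UNIV"
  proof (rule Infinite_Sum.abs_summable_on_comparison_test')
    show "norm (f i * p i) \<le> (f i)\<^sup>2 * p i + p i" for i
    proof -
      have "2 * \<bar>f i\<bar> \<le> (f i)\<^sup>2 + 1"
        using sum_squares_bound[of "\<bar>f i\<bar>" 1] by simp
      then have "\<bar>f i\<bar> \<le> (f i)\<^sup>2 + 1" by linarith
      then have "\<bar>f i\<bar> * p i \<le> ((f i)\<^sup>2 + 1) * p i" by (intro mult_right_mono p0)
      then show ?thesis using p0[of i] by (simp add: abs_mult algebra_simps)
    qed
  qed
  then have fp: "(\<lambda>i. f i * p i) summable_on UNIV"
    by (rule abs_summable_summable)
  have eq: "(f i - t)\<^sup>2 * p i = (f i)\<^sup>2 * p i + ((- 2 * t) * (f i * p i) + t\<^sup>2 * p i)" for i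
    by (simp add: power2_diff algebra_simps)
  have "((\<lambda>i. (f i - t)\<^sup>2 * p i) has_sum
      pairing (\<lambda>i. (f i)\<^sup>2) p + ((- 2 * t) * pairing f p + t\<^sup>2 * 1)) UNIV"
    unfolding eq pairing_def p(2)[symmetric]
    by (intro has_sum_add has_sum_cmult_right has_sum_infsum f2 fp p)
  then show "(\<lambda>i. (f i - t)\<^sup>2 * p i) summable_on UNIV"
    and "pairing (\<lambda>i. (f i)\<^sup>2) p - (pairing f p)\<^sup>2 \<le> (\<Sum>\<^sub>\<infinity>i. (f i - t)\<^sup>2 * p i)"
    using zero_le_power2[of "pairing f p - t"]
    by (auto simp: summable_on_def infsumI power2_diff algebra_simps)
qed

section \<open>Poincare inequality on the grid\<close>

text \<open>The factor \<open>2 * h\<^sup>2 * Z\<close> clears all normalisations and leaves one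
  nonnegative term per neighbour of \<open>i\<close>; each estimate keeps one of them and drops the
  other.\<close>

lemma Gamma_h_pi_ge:
  fixes u :: "real \<Rightarrow> real" and h :: real and f :: "int \<Rightarrow> real"
  defines "w \<equiv> \<lambda>i. exp (- grid u h i)" and "Z \<equiv> (\<Sum>\<^sub>\<infinity>j. exp (- grid u h j))"
  assumes B: "admissible B" and "Z > 0" and "h > 0"
  shows "min (w i) (w (i + 1)) * (f (i + 1) - f i)\<^sup>2 \<le> 2 * h\<^sup>2 * Z * (Gamma_h B u h f f i * pi_h u h i)"
    and "min (w i) (w (i - 1)) * (f (i - 1) - f i)\<^sup>2 \<le> 2 * h\<^sup>2 * Z * (Gamma_h B u h f f i * pi_h u h i)"
proof -
  define a where "a = w i * B (grid u h (i + 1) - grid u h i)"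
  define b where "b = w i * B (grid u h (i - 1) - grid u h i)"
  have a: "min (w i) (w (i + 1)) \<le> a" and b: "min (w i) (w (i - 1)) \<le> b"
    unfolding a_def b_def w_def by (rule admissible_edge_weight[OF B])+
  have "0 \<le> min (w i) (w (i + 1))" "0 \<le> min (w i) (w (i - 1))"
    by (simp_all add: w_def)
  then have a0: "0 \<le> a" and b0: "0 \<le> b" using a b by linarith+
  have "2 * h\<^sup>2 * Z * (Gamma_h B u h f f i * pi_h u h i)
      = a * (f (i + 1) - f i)\<^sup>2 + b * (f (i - 1) - f i)\<^sup>2"
    using \<open>Z > 0\<close> \<open>h > 0\<close>
    unfolding Gamma_h_def alpha_def beta_def pi_h_def Delta_plus_def Delta_minus_def a_def b_def
      w_def Z_def[symmetric]
    by (simp add: power2_eq_square) (simp add: field_simps)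
  then show "min (w i) (w (i + 1)) * (f (i + 1) - f i)\<^sup>2 \<le> 2 * h\<^sup>2 * Z * (Gamma_h B u h f f i * pi_h u h i)"
    and "min (w i) (w (i - 1)) * (f (i - 1) - f i)\<^sup>2 \<le> 2 * h\<^sup>2 * Z * (Gamma_h B u h f f i * pi_h u h i)"
    using mult_right_mono[OF a, of "(f (i + 1) - f i)\<^sup>2"] mult_right_mono[OF b, of "(f (i - 1) - f i)\<^sup>2"]
      mult_nonneg_nonneg[OF a0, of "(f (i + 1) - f i)\<^sup>2"] mult_nonneg_nonneg[OF b0, of "(f (i - 1) - f i)\<^sup>2"]
    by simp_all
qed

text \<open>The Hardy inequality is applied to \<open>f - f 0\<close> on each half-line. Its
  \<open>1 / h\<^sup>2\<close> cancels against the \<open>h\<^sup>2\<close> of the edge estimate, so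
  the constant depends only on \<open>c\<close> and \<open>L\<close>.\<close>

lemma discrete_poincare:
  fixes u :: "real \<Rightarrow> real"
  assumes B: "admissible B"
    and growth_pos: "\<And>x y. 0 \<le> x \<Longrightarrow> x \<le> y \<Longrightarrow> c * (y - x) - L \<le> u y - u x"
    and growth_neg: "\<And>x y. 0 \<le> x \<Longrightarrow> x \<le> y \<Longrightarrow> c * (y - x) - L \<le> u (- y) - u (- x)"
    and ch: "c > 0" "h > 0" "c * h \<le> 1"
    and f: "f \<in> H1 B u h"
  shows "pairing (\<lambda>i. (f i)\<^sup>2) (pi_h u h) - (pairing f (pi_h u h))\<^sup>2
    \<le> 16 * (2 * exp L / c)\<^sup>2 * pairing (Gamma_h B u h f f) (pi_h u h)"
proof -
  define w where "w i = exp (- grid u h i)" for i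
  define Z where "Z = infsum w UNIV"
  define G where "G = pairing (Gamma_h B u h f f) (pi_h u h)"
  define C where "C = 2 * exp L / c"
  have w_pos: "w (int i) = exp (- u (real i * h))"
    and w_neg: "w (- int i) = exp (- u (- (real i * h)))" for i
    by (simp_all add: w_def grid_def)
  define K where "K = 2 * exp L / (c * h)"
  have tail_pos: "(\<Sum>i\<le>N. w (int i)) \<le> K * w 0" for N
    using exp_weight_tail[OF growth_pos ch, of 0 N]
    by (simp add: w_def grid_def K_def atMost_atLeast0)
  have tail_neg: "(\<Sum>i\<le>N. w (- int i)) \<le> K * w 0" for N
    using exp_weight_tail[of c L "\<lambda>x. u (- x)", OF growth_neg ch, of 0 N]
    by (simp add: w_def grid_def K_def atMost_atLeast0)
  \<comment> \<open>Without summability the normalising sum would take the default value 0 and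
    \<open>pi_h\<close> would not be a probability.\<close>
  have w_summable: "w summable_on UNIV"
  proof (rule nonneg_bdd_above_summable_on)
    show "bdd_above (sum w ` {F. F \<subseteq> UNIV \<and> finite F})"
    proof (rule bdd_aboveI2)
      fix X :: "int set" assume "X \<in> {F. F \<subseteq> UNIV \<and> finite F}"
      then show "sum w X \<le> K * w 0 + K * w 0"
        by (intro sum_int_le_half_lines tail_pos tail_neg) (auto simp: w_def)
    qed
  qed (simp add: w_def)
  have "w 0 \<le> Z"
    unfolding Z_def using finite_sum_le_infsum[OF w_summable, of "{0}"] by (simp add: w_def)
  then have Z: "Z > 0" by (simp add: w_def less_le_trans[OF exp_gt_zero])
  have Z_eq: "Z = (\<Sum>\<^sub>\<infinity>j. exp (- grid u h j))" unfolding Z_def w_def[abs_def] ..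
  have pi: "pi_h u h i = w i / Z" for i by (simp add: pi_h_def w_def Z_eq)
  have pi_sum: "((\<lambda>i. w i / Z) has_sum (Z / Z)) UNIV"
    unfolding divide_inverse by (intro has_sum_cmult_left) (simp add: Z_def w_summable has_sum_infsum)
  have pi1: "pi_h u h summable_on UNIV" "infsum (pi_h u h) UNIV = 1"
    using pi_sum Z infsumI[OF pi_sum] unfolding pi[abs_def] by (auto simp: summable_on_def)
  have pi0: "0 \<le> pi_h u h i" for i using Z by (simp add: pi w_def)
  have f2: "(\<lambda>i. (f i)\<^sup>2 * pi_h u h i) summable_on UNIV"
    and \<Gamma>: "(\<lambda>i. Gamma_h B u h f f i * pi_h u h i) summable_on UNIV"
    using f by (auto simp: H1_def)
  note edge = Gamma_h_pi_ge[OF B, of u h, folded Z_eq w_def, OF Z ch(2), where f = f]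
  have "0 \<le> Gamma_h B u h f f i * pi_h u h i" for i
  proof -
    have "0 \<le> min (w i) (w (i + 1)) * (f (i + 1) - f i)\<^sup>2" by (simp add: w_def)
    with edge(1)[of i] have "0 \<le> 2 * h\<^sup>2 * Z * (Gamma_h B u h f f i * pi_h u h i)" by linarith
    moreover have "0 < 2 * h\<^sup>2 * Z" using Z ch by simp
    ultimately show ?thesis by (simp only: zero_le_mult_iff) linarith
  qed
  \<comment> \<open>Any injective indexing \<open>s\<close> is allowed, so the same bound serves
    both half-lines.\<close>
  then have partial: "(\<Sum>k<N. Gamma_h B u h f f (s k) * pi_h u h (s k)) \<le> G" if "inj s" for N :: nat and s
    using finite_sum_le_infsum[OF \<Gamma>, of "s ` {..<N}"] that
    by (simp add: G_def pairing_def sum.reindex inj_on_subset)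
  have half: "(\<Sum>i\<le>N. (f (s i) - f 0)\<^sup>2 * pi_h u h (s i)) \<le> 8 * C\<^sup>2 * G"
    if hardy: "(\<Sum>i\<le>N. w (s i) * (f (s i) - f 0)\<^sup>2) \<le> 4 * (2 * exp L / (c * h))\<^sup>2 *
        (\<Sum>k<N. min (w (s k)) (w (s (Suc k))) * ((f (s (Suc k)) - f 0) - (f (s k) - f 0))\<^sup>2)"
      and step: "\<And>k. min (w (s k)) (w (s (Suc k))) * (f (s (Suc k)) - f (s k))\<^sup>2
        \<le> 2 * h\<^sup>2 * Z * (Gamma_h B u h f f (s k) * pi_h u h (s k))"
      and "inj s"
    for s :: "nat \<Rightarrow> int" and N
  proof -
    have "(\<Sum>k<N. min (w (s k)) (w (s (Suc k))) * ((f (s (Suc k)) - f 0) - (f (s k) - f 0))\<^sup>2)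
        \<le> (\<Sum>k<N. 2 * h\<^sup>2 * Z * (Gamma_h B u h f f (s k) * pi_h u h (s k)))"
      by (intro sum_mono) (use step in simp)
    also have "\<dots> \<le> 2 * h\<^sup>2 * Z * G"
      unfolding sum_distrib_left[symmetric]
      using Z by (intro mult_left_mono partial \<open>inj s\<close>) auto
    finally have "(\<Sum>i\<le>N. w (s i) * (f (s i) - f 0)\<^sup>2)
        \<le> 4 * (2 * exp L / (c * h))\<^sup>2 * (2 * h\<^sup>2 * Z * G)"
      using hardy by (meson mult_left_mono order_trans zero_le_power2 mult_nonneg_nonneg zero_le_numeral)
    \<comment> \<open>Here the powers of \<open>h\<close> cancel; the remaining \<open>Z\<close> is
      the normalisation of \<open>pi_h\<close>.\<close>
    also have "\<dots> = 8 * C\<^sup>2 * G * Z"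
      using ch by (simp add: C_def power_divide power_mult_distrib)
    finally have "(\<Sum>i\<le>N. w (s i) * (f (s i) - f 0)\<^sup>2) / Z \<le> 8 * C\<^sup>2 * G"
      using Z by (simp add: divide_le_eq)
    then show ?thesis by (simp add: pi sum_divide_distrib mult.commute)
  qed
  have "(\<Sum>\<^sub>\<infinity>i. (f i - f 0)\<^sup>2 * pi_h u h i) \<le> 8 * C\<^sup>2 * G + 8 * C\<^sup>2 * G"
  proof (rule infsum_le_finite_sums[OF variance_le_second_moment(1)[OF pi0 pi1 f2]])
    fix X :: "int set" assume "finite X"
    then show "(\<Sum>i\<in>X. (f i - f 0)\<^sup>2 * pi_h u h i) \<le> 8 * C\<^sup>2 * G + 8 * C\<^sup>2 * G"
    proof (rule sum_int_le_half_lines[rotated])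
      show "(\<Sum>i\<le>N. (f (int i) - f 0)\<^sup>2 * pi_h u h (int i)) \<le> 8 * C\<^sup>2 * G" for N
      proof (rule half[of int])
        show "(\<Sum>i\<le>N. w (int i) * (f (int i) - f 0)\<^sup>2) \<le> 4 * (2 * exp L / (c * h))\<^sup>2 *
            (\<Sum>k<N. min (w (int k)) (w (int (Suc k))) * ((f (int (Suc k)) - f 0) - (f (int k) - f 0))\<^sup>2)"
          unfolding w_pos by (rule half_line_hardy[OF growth_pos ch, where g = "\<lambda>i. f (int i) - f 0"]) simp_all
        show "min (w (int k)) (w (int (Suc k))) * (f (int (Suc k)) - f (int k))\<^sup>2
            \<le> 2 * h\<^sup>2 * Z * (Gamma_h B u h f f (int k) * pi_h u h (int k))" for k
          using edge(1)[of "int k"] by (simp add: add.commute)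
      qed simp
      show "(\<Sum>i\<le>N. (f (- int i) - f 0)\<^sup>2 * pi_h u h (- int i)) \<le> 8 * C\<^sup>2 * G" for N
      proof (rule half[of "\<lambda>i. - int i"])
        show "(\<Sum>i\<le>N. w (- int i) * (f (- int i) - f 0)\<^sup>2) \<le> 4 * (2 * exp L / (c * h))\<^sup>2 *
            (\<Sum>k<N. min (w (- int k)) (w (- int (Suc k))) * ((f (- int (Suc k)) - f 0) - (f (- int k) - f 0))\<^sup>2)"
          unfolding w_neg
          by (rule half_line_hardy[of c L "\<lambda>x. u (- x)", OF growth_neg ch,
            where g = "\<lambda>i. f (- int i) - f 0"]) simp_all
        \<comment> \<open>Moving outwards on the negative half-line decreases the index, so the
          backward-edge estimate applies.\<close>
        have "- int (Suc k) = - int k - 1" for k by simp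
        then show "min (w (- int k)) (w (- int (Suc k))) * (f (- int (Suc k)) - f (- int k))\<^sup>2
            \<le> 2 * h\<^sup>2 * Z * (Gamma_h B u h f f (- int k) * pi_h u h (- int k))" for k
          using edge(2)[of "- int k"] by metis
      qed (simp add: inj_on_def)
    qed (simp add: pi0)
  qed
  then show ?thesis
    using variance_le_second_moment(2)[OF pi0 pi1 f2, of "f 0"] unfolding G_def C_def by linarith
qed

theorem theorem1p5:
  fixes B u :: "real \<Rightarrow> real" and a M :: real
  assumes "admissible B"
    and "smooth u"
    and "a > 0" and "M > 0"
    and "\<And>x. \<bar>x\<bar> > M \<Longrightarrow> x * deriv u x \<ge> a * \<bar>x\<bar>\<^sup>2"
  shows "\<exists>h0 > 0. \<exists>\<kappa> > 0. \<forall>h. 0 < h \<and> h < h0 \<longrightarrow>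
           (\<forall>f \<in> H1 B u h.
              pairing (\<lambda>i. (f i)\<^sup>2) (pi_h u h) - (pairing f (pi_h u h))\<^sup>2
                \<le> 1 / \<kappa> * pairing (Gamma_h B u h f f) (pi_h u h))"
proof -
  \<comment> \<open>Dividing the hypothesis by the absolute value of \<open>x\<close> gives outward
    slope at least \<open>a * \<bar>x\<bar>\<close>, which is at least \<open>a * M\<close> beyond
    \<open>M\<close>.\<close>
  define c where "c = a * M"
  have c: "c > 0" using assms by (simp add: c_def)
  have der: "(u has_real_derivative deriv u x) (at x)" for x
    using assms(2) unfolding smooth_def
    by (metis DERIV_deriv_iff_field_differentiable funpow_0)
  have slope: "c \<le> sgn x * deriv u x" if "\<bar>x\<bar> > M" for x
  proof -
    have x: "\<bar>x\<bar> > 0" using that \<open>M > 0\<close> by linarith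
    have "x * deriv u x = \<bar>x\<bar> * (sgn x * deriv u x)"
      by (cases x "0 :: real" rule: linorder_cases) auto
    then have "\<bar>x\<bar> * (a * \<bar>x\<bar>) \<le> \<bar>x\<bar> * (sgn x * deriv u x)"
      using assms(5)[OF that] unfolding power2_eq_square by (simp only: mult.left_commute)
    then have "a * \<bar>x\<bar> \<le> sgn x * deriv u x" using x by (simp only: mult_le_cancel_left_pos)
    moreover have "c \<le> a * \<bar>x\<bar>" unfolding c_def using assms(3) that by (intro mult_left_mono) auto
    ultimately show ?thesis by linarith
  qed
  have "c \<le> deriv u x" if "x > M" for x
    using slope[of x] that \<open>M > 0\<close> by simp
  then obtain L1 where L1: "\<And>x y. 0 \<le> x \<Longrightarrow> x \<le> y \<Longrightarrow> c * (y - x) - L1 \<le> u y - u x"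
    using linear_growth_from_derivative[OF der \<open>M > 0\<close>] by blast
  \<comment> \<open>Reflection turns growth on the negative half-line into the case already
    treated.\<close>
  have der_neg: "((\<lambda>x. u (- x)) has_real_derivative - deriv u (- x)) (at x)" for x
    using DERIV_mirror[THEN iffD1, OF der] .
  have "c \<le> - deriv u (- x)" if "x > M" for x
    using slope[of "- x"] that \<open>M > 0\<close> by simp
  then obtain L2 where L2: "\<And>x y. 0 \<le> x \<Longrightarrow> x \<le> y \<Longrightarrow> c * (y - x) - L2 \<le> u (- y) - u (- x)"
    using linear_growth_from_derivative[OF der_neg \<open>M > 0\<close>] by blast
  define L where "L = max L1 L2"
  define \<kappa> where "\<kappa> = 1 / (16 * (2 * exp L / c)\<^sup>2)"
  have growth: "c * (y - x) - L \<le> u y - u x" "c * (y - x) - L \<le> u (- y) - u (- x)"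
    if "0 \<le> x" "x \<le> y" for x y
    using L1[OF that] L2[OF that] by (auto simp: L_def)
  show ?thesis
  \<comment> \<open>The threshold \<open>1 / c\<close> guarantees \<open>c * h \<le> 1\<close>, as
    the geometric-series bound requires; \<open>\<kappa>\<close> was fixed from \<open>c\<close> and
    \<open>L\<close> before \<open>h\<close> appears.\<close>
  proof (rule exI[of _ "1 / c"], intro conjI exI[of _ \<kappa>] allI impI ballI)
    show "1 / c > 0" "\<kappa> > 0" using c by (simp_all add: \<kappa>_def)
    fix h f assume h: "0 < h \<and> h < 1 / c" and f: "f \<in> H1 B u h"
    have "c * h \<le> 1" using h c by (simp add: field_simps)
    then show "pairing (\<lambda>i. (f i)\<^sup>2) (pi_h u h) - (pairing f (pi_h u h))\<^sup>2
        \<le> 1 / \<kappa> * pairing (Gamma_h B u h f f) (pi_h u h)"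
      using discrete_poincare[OF assms(1) growth c _ _ f] h by (simp add: \<kappa>_def)
  qed
qed

end
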